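(* Let $Q\in\mathbb{R}^{n\times n}$ and $R\in\mathbb{R}^{m\times m}$ be symmetric positive definite, let $\mathcal{M}\subset\mathbb{R}^{n\times n}\times\mathbb{R}^{n\times m}$ be a nonempty compact set, and let $\gamma>0$. Let $J_\mu(x_0)$, $J_*(x_0)$, $G_*(x_0)$, $\mathcal{F}$ and $\mathcal{F}_u$ be as defined in the context, and define functions $V_0,V_1,V_2,\ldots$ on $\mathbb{R}^n\times\mathbb{S}$ by $$V_0(x,Z)=-\gamma^2\min_{(A,B)\in\mathcal{M}}\left\|\begin{bmatrix}I&A&B\end{bmatrix}^\top\right\|_Z^2,\qquad V_{k+1}(x,Z)=\mathcal{F}V_k(x,Z).$$ Then: (1) For every $x_0\in\mathbb{R}^n$, $J_*(x_0)=G_*(x_0)$ (the two values may be $+\infty$). This common value is finite if and only if the sequence $\{V_k(x_0,0)\}_{k=0}^\infty$ is upper bounded. (2) Suppose that the sequence $\{V_k(x,0)\}_{k=0}^\infty$ is upper bounded for every $x\in\mathbb{R}^n$. Then the pointwise limit $V_*:=\lim_{k\to\infty}V_k$ exists (as a finite function on $\mathbb{R}^n\times\mathbb{S}$), and $J_*(x_0)=V_*(x_0,0)$ for all $x_0$. Defining $\eta^*(x,Z)$ as a minimizing value of $u$ in the expression for $\mathcal{F}V_*(x,Z)$, i.e. $\mathcal{F}_{\eta^*(x,Z)}V_*(x,Z)=\mathcal{F}V_*(x,Z)$, gives a control law $u_t=\eta^*(x_t,Z_t)$ that is optimal for (attains the infimum in) the problem defining $G_*(x_0)$, while the control law $\mu^*$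 defined by $$\mu_t^*(x_0,\ldots,x_t,u_0,\ldots,u_{t-1}):=\eta^*\left(x_t,\ \sum_{\tau=0}^{t-1}\begin{bmatrix}-x_{\tau+1}\\ x_\tau\\ u_\tau\end{bmatrix}\begin{bmatrix}-x_{\tau+1}\\ x_\tau\\ u_\tau\end{bmatrix}^\top\right)$$ is optimal for the problem defining $J_*(x_0)$, i.e. $J_{\mu^*}(x_0)=J_*(x_0)$. (3) Moreover, if there exist a function $\bar V$ on $\mathbb{R}^n\times\mathbb{S}$ and a map $\bar\eta:\mathbb{R}^n\times\mathbb{S}\to\mathbb{R}^m$ such that $\bar V\ge V_0$ and $\mathcal{F}_{\bar\eta(x,Z)}\bar V(x,Z)\le\bar V(x,Z)$ for all $(x,Z)\in\mathbb{R}^n\times\mathbb{S}$, then the control law $\bar\mu$ defined by $u_t=\bar\eta(x_t,Z_t)$, with $Z_t=\sum_{\tau=0}^{t-1}\begin{bmatrix}-x_{\tau+1}\\ x_\tau\\ u_\tau\end{bmatrix}\begin{bmatrix}-x_{\tau+1}\\ x_\tau\\ u_\tau\end{bmatrix}^\top$, satisfies $J_{\bar\mu}(x_0)\le\bar V(x_0,0)$ for all $x_0\in\mathbb{R}^n$.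
   Context: Notation: for a vector $x$ and a symmetric matrix $M$, $|x|_M^2:=x^\top Mx$, and $|x|$ is the Euclidean norm. For a matrix $B$ and a symmetric $M$ of compatible size, $\|B\|_M^2:=\operatorname{trace}(B^\top MB)$. $\mathbb{S}$ denotes the set of symmetric positive semidefinite matrices in $\mathbb{R}^{(2n+m)\times(2n+m)}$. For $(A,B)\in\mathbb{R}^{n\times n}\times\mathbb{R}^{n\times m}$, $\begin{bmatrix}I&A&B\end{bmatrix}\in\mathbb{R}^{n\times(2n+m)}$. All functions on $\mathbb{R}^n\times\mathbb{S}$ take values in $\mathbb{R}\cup\{+\infty\}$, and inequalities between them are pointwise. First problem. A control law $\mu=(\mu_t)_{t\ge0}$ is an arbitrary sequence of functions giving $u_t=\mu_t(x_0,\ldots,x_t,u_0,\ldots,u_{t-1})\in\mathbb{R}^m$. For $x_0\in\mathbb{R}^n$, $$J_\mu(x_0):=\sup_{w,A,B,N}\sum_{t=0}^N\left(|x_t|_Q^2+|u_t|_R^2-\gamma^2|w_t|^2\right),\qquad J_*(x_0):=\inf_\mu J_\mu(x_0),$$ where the supremum is over $(A,B)\in\mathcal{M}$, integers $N\ge0$ and sequences $w_t\in\mathbb{R}^n$, and $x,u$ are generated by $x_{t+1}=Ax_t+Bu_t+w_t$ for $t\ge0$ together with the control law $\mu$. Second problem. For $x_0\in\mathbb{R}^n$, $$G_*(x_0):=\inf_\eta\sup_{v,N}\left[\sum_{t=0}^N\left(|x_t|_Q^2+|u_t|_R^2\right)-\gamma^2\min_{(A,B)\in\mathcal{M}}\left\|\begin{bmatrix}I&A&B\end{bmatrix}^\top\right\|_{Z_{N+1}}^2\right],$$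 where the infimum is over maps $\eta:\mathbb{R}^n\times\mathbb{S}\to\mathbb{R}^m$, the supremum is over integers $N\ge0$ and sequences $v_t\in\mathbb{R}^n$, and $x,Z,u$ are generated from $x_0$ by $$x_{t+1}=v_t,\qquad Z_{t+1}=Z_t+\begin{bmatrix}-v_t\\ x_t\\ u_t\end{bmatrix}\begin{bmatrix}-v_t\\ x_t\\ u_t\end{bmatrix}^\top,\quad Z_0=0,\qquad u_t=\eta(x_t,Z_t).$$ Bellman operators. For a function $V$ on $\mathbb{R}^n\times\mathbb{S}$ and $u\in\mathbb{R}^m$, $$\mathcal{F}_uV(x,Z):=\max_{v\in\mathbb{R}^n}\left\{|x|_Q^2+|u|_R^2+V\left(v,Z+\begin{bmatrix}-v\\ x\\ u\end{bmatrix}\begin{bmatrix}-v\\ x\\ u\end{bmatrix}^\top\right)\right\},\qquad \mathcal{F}V(x,Z):=\min_{u\in\mathbb{R}^m}\mathcal{F}_uV(x,Z),$$ where max and min are understood as supremum and infimum with values in $\mathbb{R}\cup\{+\infty\}$ when not known to be attained. *)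

theory Defs
  imports "HOL-Analysis.Analysis"
begin

section \<open>Weighted norms and block matrices\<close>

type_synonym ('n, 'm) blockvec = "real^('n + 'n + 'm)"
type_synonym ('n, 'm) blockmat = "real^('n + 'n + 'm)^('n + 'n + 'm)"
type_synonym ('n, 'm) control_law = "nat \<Rightarrow> (real^'n) list \<Rightarrow> (real^'m) list \<Rightarrow> real^'m"
type_synonym ('n, 'm) feedback = "real^'n \<Rightarrow> ('n, 'm) blockmat \<Rightarrow> real^'m"
type_synonym ('n, 'm) value_fun = "real^'n \<Rightarrow> ('n, 'm) blockmat \<Rightarrow> ereal"

definition sym_pos_def :: "real^'a^'a \<Rightarrow> bool" where
  "sym_pos_def P \<longleftrightarrow> transpose P = P \<and> (\<forall>x. x \<noteq> 0 \<longrightarrow> 0 < x \<bullet> (P *v x))"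

definition sym_psd :: "(real^'a^'a) set" where
  "sym_psd = {P. transpose P = P \<and> (\<forall>x. 0 \<le> x \<bullet> (P *v x))}"

definition wnorm2 :: "real^'a^'a \<Rightarrow> real^'a \<Rightarrow> real" where
  "wnorm2 P x = x \<bullet> (P *v x)"

definition mat_wnorm2 :: "real^'a^'a \<Rightarrow> real^'b^'a \<Rightarrow> real" where
  "mat_wnorm2 P B = trace (transpose B ** P ** B)"

definition block_row :: "real^'n^'n \<Rightarrow> real^'m^'n \<Rightarrow> real^('n + 'n + 'm)^'n" where
  "block_row A B = (\<chi> i j. case j of
      Inl k \<Rightarrow> mat 1 $ i $ k
    | Inr (Inl k) \<Rightarrow> A $ i $ k
    | Inr (Inr k) \<Rightarrow> B $ i $ k)"

definition block_col :: "real^'n \<Rightarrow> real^'n \<Rightarrow> real^'m \<Rightarrow> ('n, 'm) blockvec" where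
  "block_col a b c = (\<chi> i. case i of
      Inl k \<Rightarrow> a $ k
    | Inr (Inl k) \<Rightarrow> b $ k
    | Inr (Inr k) \<Rightarrow> c $ k)"

definition outer :: "real^'a \<Rightarrow> real^'a^'a" where
  "outer z = (\<chi> i j. z $ i * z $ j)"

text \<open>The minimum over the model set is written as an infimum of reals; it is attained
  whenever \<open>M\<close> is nonempty and compact.\<close>

definition min_misfit ::
    "((real^'n^'n) \<times> (real^'m^'n)) set \<Rightarrow> ('n, 'm) blockmat \<Rightarrow> real" where
  "min_misfit M Z = (INF (A, B)\<in>M. mat_wnorm2 Z (transpose (block_row A B)))"


section \<open>First problem: unknown model, history-dependent control\<close>

text \<open>A control law receives at time \<open>t\<close> the lists \<open>[x 0, ..., x t]\<close> and
  \<open>[u 0, ..., u (t - 1)]\<close>; its values on lists of other lengths are irrelevant.\<close>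

definition trajectory ::
    "real^'n^'n \<Rightarrow> real^'m^'n \<Rightarrow> ('n, 'm) control_law \<Rightarrow> real^'n \<Rightarrow>
     (nat \<Rightarrow> real^'n) \<Rightarrow> (nat \<Rightarrow> real^'n) \<Rightarrow> (nat \<Rightarrow> real^'m) \<Rightarrow> bool" where
  "trajectory A B \<mu> x0 w x u \<longleftrightarrow>
     x 0 = x0 \<and>
     (\<forall>t. u t = \<mu> t (map x [0..<Suc t]) (map u [0..<t])) \<and>
     (\<forall>t. x (Suc t) = A *v x t + B *v u t + w t)"

lemma trajectory_exists: "\<exists>x u. trajectory A B \<mu> x0 w x u"
proof -
  define H where "H = rec_nat ([x0], [])
    (\<lambda>t (xs, us). (xs @ [A *v last xs + B *v \<mu> t xs us + w t], us @ [\<mu> t xs us]))"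
  define x where "x t = last (fst (H t))" for t
  define u where "u t = \<mu> t (fst (H t)) (snd (H t))" for t
  have H0: "H 0 = ([x0], [])"
    by (simp add: H_def)
  have HS: "H (Suc t) = (fst (H t) @ [A *v x t + B *v u t + w t], snd (H t) @ [u t])" for t
    by (simp add: H_def x_def u_def split_beta)
  have xS: "x (Suc t) = A *v x t + B *v u t + w t" for t
    by (subst x_def) (simp add: HS)
  have x0: "x 0 = x0"
    by (simp add: x_def H0)
  have "H t = (map x [0..<Suc t], map u [0..<t])" for t
    by (induction t) (simp_all add: H0 HS x0 xS)
  then have "u t = \<mu> t (map x [0..<Suc t]) (map u [0..<t])" for t
    by (subst u_def) simp
  with x0 xS have "trajectory A B \<mu> x0 w x u"
    unfolding trajectory_def by blast
  then show ?thesis by blast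
qed

definition J_cost ::
    "real^'n^'n \<Rightarrow> real^'m^'m \<Rightarrow> real \<Rightarrow> ((real^'n^'n) \<times> (real^'m^'n)) set \<Rightarrow>
     ('n, 'm) control_law \<Rightarrow> real^'n \<Rightarrow> ereal" where
  "J_cost Q R \<gamma> M \<mu> x0 =
     Sup {ereal (\<Sum>t=0..N. wnorm2 Q (x t) + wnorm2 R (u t) - \<gamma>\<^sup>2 * (norm (w t))\<^sup>2)
          | w A B N x u. (A, B) \<in> M \<and> trajectory A B \<mu> x0 w x u}"

definition J_opt ::
    "real^'n^'n \<Rightarrow> real^'m^'m \<Rightarrow> real \<Rightarrow> ((real^'n^'n) \<times> (real^'m^'n)) set \<Rightarrow>
     real^'n \<Rightarrow> ereal" where
  "J_opt Q R \<gamma> M x0 = (INF \<mu>. J_cost Q R \<gamma> M \<mu> x0)"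


section \<open>Second problem: feedback from the state and the data matrix\<close>

definition data_trajectory ::
    "('n, 'm) feedback \<Rightarrow> real^'n \<Rightarrow> (nat \<Rightarrow> real^'n) \<Rightarrow>
     (nat \<Rightarrow> real^'n) \<Rightarrow> (nat \<Rightarrow> ('n, 'm) blockmat) \<Rightarrow> (nat \<Rightarrow> real^'m) \<Rightarrow> bool" where
  "data_trajectory \<eta> x0 v x Z u \<longleftrightarrow>
     x 0 = x0 \<and> Z 0 = 0 \<and>
     (\<forall>t. x (Suc t) = v t) \<and>
     (\<forall>t. Z (Suc t) = Z t + outer (block_col (- v t) (x t) (u t))) \<and>
     (\<forall>t. u t = \<eta> (x t) (Z t))"

lemma data_trajectory_exists: "\<exists>x Z u. data_trajectory \<eta> x0 v x Z u"
proof -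
  define x where "x = case_nat x0 v"
  define Z where "Z = rec_nat 0 (\<lambda>t Y. Y + outer (block_col (- v t) (x t) (\<eta> (x t) Y)))"
  have "data_trajectory \<eta> x0 v x Z (\<lambda>t. \<eta> (x t) (Z t))"
    by (simp add: data_trajectory_def x_def Z_def)
  then show ?thesis by blast
qed

definition G_cost ::
    "real^'n^'n \<Rightarrow> real^'m^'m \<Rightarrow> real \<Rightarrow> ((real^'n^'n) \<times> (real^'m^'n)) set \<Rightarrow>
     ('n, 'm) feedback \<Rightarrow> real^'n \<Rightarrow> ereal" where
  "G_cost Q R \<gamma> M \<eta> x0 =
     Sup {ereal ((\<Sum>t=0..N. wnorm2 Q (x t) + wnorm2 R (u t)) - \<gamma>\<^sup>2 * min_misfit M (Z (N + 1)))
          | v N x Z u. data_trajectory \<eta> x0 v x Z u}"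

definition G_opt ::
    "real^'n^'n \<Rightarrow> real^'m^'m \<Rightarrow> real \<Rightarrow> ((real^'n^'n) \<times> (real^'m^'n)) set \<Rightarrow>
     real^'n \<Rightarrow> ereal" where
  "G_opt Q R \<gamma> M x0 = (INF \<eta>. G_cost Q R \<gamma> M \<eta> x0)"

definition induced_law :: "('n::finite, 'm::finite) feedback \<Rightarrow> ('n, 'm) control_law" where
  "induced_law \<eta> t xs us =
     \<eta> (xs ! t) (\<Sum>\<tau><t. outer (block_col (- (xs ! Suc \<tau>)) (xs ! \<tau>) (us ! \<tau>)))"


section \<open>Bellman operators and value iteration\<close>

text \<open>Value functions are total on matrices, but only their values on \<^const>\<open>sym_psd\<close> are
  meaningful; the operators below stay inside this set because \<open>Z + outer z\<close> is in
  \<^const>\<open>sym_psd\<close> whenever \<open>Z\<close> is.\<close>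

definition bellman_u ::
    "real^'n^'n \<Rightarrow> real^'m^'m \<Rightarrow> real^'m \<Rightarrow> ('n, 'm) value_fun \<Rightarrow> ('n, 'm) value_fun" where
  "bellman_u Q R u V x Z =
     (SUP v. ereal (wnorm2 Q x + wnorm2 R u) + V v (Z + outer (block_col (- v) x u)))"

definition bellman ::
    "real^'n^'n \<Rightarrow> real^'m^'m \<Rightarrow> ('n, 'm) value_fun \<Rightarrow> ('n, 'm) value_fun" where
  "bellman Q R V x Z = (INF u. bellman_u Q R u V x Z)"

primrec value_iter ::
    "real^'n^'n \<Rightarrow> real^'m^'m \<Rightarrow> real \<Rightarrow> ((real^'n^'n) \<times> (real^'m^'n)) set \<Rightarrow>
     nat \<Rightarrow> ('n, 'm) value_fun" where
  "value_iter Q R \<gamma> M 0 = (\<lambda>x Z. ereal (- \<gamma>\<^sup>2 * min_misfit M Z))"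
| "value_iter Q R \<gamma> M (Suc k) = bellman Q R (value_iter Q R \<gamma> M k)"

definition value_lim ::
    "real^'n^'n \<Rightarrow> real^'m^'m \<Rightarrow> real \<Rightarrow> ((real^'n^'n) \<times> (real^'m^'n)) set \<Rightarrow>
     ('n, 'm) value_fun" where
  "value_lim Q R \<gamma> M x Z = lim (\<lambda>k. value_iter Q R \<gamma> M k x Z)"

definition is_minimizer ::
    "real^'n^'n \<Rightarrow> real^'m^'m \<Rightarrow> ('n, 'm) value_fun \<Rightarrow> ('n, 'm) feedback \<Rightarrow> bool" where
  "is_minimizer Q R V \<eta> \<longleftrightarrow>
     (\<forall>x. \<forall>Z\<in>sym_psd. bellman_u Q R (\<eta> x Z) V x Z = bellman Q R V x Z)"

definition upper_bounded :: "(nat \<Rightarrow> ereal) \<Rightarrow> bool" where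
  "upper_bounded a \<longleftrightarrow> (\<exists>c::real. \<forall>k. a k \<le> ereal c)"

end

theory Submission
  imports Defs
begin

text \<open>Every iterate is lower semicontinuous and, thanks to \<open>R > 0\<close>, coercive in the input. Hence the
  supremum \<open>V\<close> of the increasing iterates is a fixed point of the Bellman operator and admits a
  minimizing feedback, even where it is infinite. At \<open>Z = 0\<close> both optimal values equal \<open>V\<close>: the
  telescoped Bellman inequality for the minimizing feedback bounds the second one above by \<open>V\<close>, a
  greedily chosen disturbance shows that no law in the first problem gets below any iterate, and
  every feedback induces a law in the first problem that costs no more.\<close>

section \<open>Lower semicontinuity and coercivity\<close>

text \<open>Closedness of the real epigraph: suprema turn into intersections and continuous
  substitutions into preimages, and infinite values need no separate treatment.\<close>

definition lsc :: "('a::topological_space \<Rightarrow> ereal) \<Rightarrow> bool" where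
  "lsc f \<longleftrightarrow> closed {(x, r). f x \<le> ereal r}"

lemma lsc_SUP:
  assumes "\<And>i. i \<in> I \<Longrightarrow> lsc (f i)"
  shows "lsc (\<lambda>x. SUP i\<in>I. f i x)"
proof -
  have "{(x, r). (SUP i\<in>I. f i x) \<le> ereal r} = (\<Inter>i\<in>I. {(x, r). f i x \<le> ereal r})"
    by (auto simp: SUP_le_iff)
  then show ?thesis
    using assms by (auto simp: lsc_def intro!: closed_INT)
qed

lemma lsc_compose:
  assumes "lsc f" "continuous_on UNIV g"
  shows "lsc (\<lambda>x. f (g x))"
proof -
  have "continuous_on UNIV (\<lambda>p. (g (fst p), snd p :: real))"
    by (intro continuous_intros continuous_on_compose2[OF assms(2)]) auto
  then have "closed ((\<lambda>p. (g (fst p), snd p)) -` {(x, r). f x \<le> ereal r})"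
    by (rule closed_vimage[OF assms(1)[unfolded lsc_def]])
  moreover have "(\<lambda>p. (g (fst p), snd p)) -` {(x, r). f x \<le> ereal r} = {(x, r). f (g x) \<le> ereal r}"
    by auto
  ultimately show ?thesis
    by (simp add: lsc_def)
qed

text \<open>The epigraph of the sum is the preimage of that of \<open>f\<close> under the shear
  sending \<open>(x, r)\<close> to \<open>(x, r - g x)\<close>.\<close>

lemma lsc_add_continuous:
  fixes g :: "'a::topological_space \<Rightarrow> real"
  assumes "lsc f" "continuous_on UNIV g"
  shows "lsc (\<lambda>x. ereal (g x) + f x)"
proof -
  have "continuous_on UNIV (\<lambda>p. (fst p, snd p - g (fst p)))"
    by (intro continuous_intros continuous_on_compose2[OF assms(2)]) auto
  then have "closed ((\<lambda>p. (fst p, snd p - g (fst p))) -` {(x, r). f x \<le> ereal r})"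
    by (rule closed_vimage[OF assms(1)[unfolded lsc_def]])
  moreover have "ereal a + b \<le> ereal r \<longleftrightarrow> b \<le> ereal (r - a)" for a b r
    by (cases b) auto
  then have "(\<lambda>p. (fst p, snd p - g (fst p))) -` {(x, r). f x \<le> ereal r}
      = {(x, r). ereal (g x) + f x \<le> ereal r}"
    by auto
  ultimately show ?thesis
    by (simp add: lsc_def)
qed

text \<open>The compactness argument behind the attainment results: coercivity bounds the inputs,
  and a limit point inherits every bound because the epigraphs are closed. Asking for level
  \<open>k\<close> only when \<open>k \<le> i\<close> admits the minimizers of an increasing
  sequence of functions.\<close>

lemma coercive_limit:
  fixes f :: "nat \<Rightarrow> 'a::metric_space \<times> 'b::euclidean_space \<Rightarrow> ereal"
  assumes lsc: "\<And>k. lsc (f k)" and h: "continuous_on UNIV h" and c: "c > 0"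
    and coercive: "\<And>x u. ereal (c * (norm u)\<^sup>2 - h x) \<le> f 0 (x, u)"
    and X: "X \<longlonglongrightarrow> x" and r: "r \<longlonglongrightarrow> r0"
    and le: "\<And>k i. k \<le> i \<Longrightarrow> f k (X i, U i) \<le> ereal (r i)"
  shows "\<exists>u. \<forall>k. f k (x, u) \<le> ereal r0"
proof -
  have "(\<lambda>i. r i + h (X i)) \<longlonglongrightarrow> r0 + h x"
    using h X r by (intro tendsto_add continuous_on_tendsto_compose[OF h]) auto
  then have "Bseq (\<lambda>i. r i + h (X i))"
    by (auto intro: convergent_imp_Bseq convergentI)
  then obtain K where K: "\<And>i. \<bar>r i + h (X i)\<bar> \<le> K"
    by (auto simp: Bseq_def)
  have "norm (U i) \<le> K / c + 1" for i
  proof -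
    have "ereal (c * (norm (U i))\<^sup>2 - h (X i)) \<le> ereal (r i)"
      using order_trans[OF coercive le[of 0 i]] by simp
    then have "c * (norm (U i))\<^sup>2 \<le> K"
      using K[of i] by simp
    then have "(norm (U i))\<^sup>2 \<le> K / c"
      using c by (simp add: field_simps)
    \<comment> \<open>For \<open>t = norm (U i)\<close> the square gives
      \<open>t \<le> 2 * t \<le> t^2 + 1\<close>, so no root of \<open>K / c\<close> is
      taken.\<close>
    moreover have "0 \<le> (norm (U i) - 1)\<^sup>2" "norm (U i) \<ge> 0"
      by auto
    ultimately show ?thesis
      unfolding power2_diff by (smt (verit) power2_eq_square mult_1_right one_power2)
  qed
  then have "bounded (range U)"
    by (auto simp: bounded_iff)
  then obtain u s where s: "strict_mono s" and u: "(U \<circ> s) \<longlonglongrightarrow> u"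
    using bounded_imp_convergent_subsequence by blast
  have "f k (x, u) \<le> ereal r0" for k
  proof -
    have "(\<lambda>i. ((X (s i), U (s i)), r (s i))) \<longlonglongrightarrow> ((x, u), r0)"
      using u LIMSEQ_subseq_LIMSEQ[OF X s] LIMSEQ_subseq_LIMSEQ[OF r s]
      by (auto simp: o_def intro!: tendsto_Pair)
    \<comment> \<open>For \<open>k \<le> i\<close> also \<open>k \<le> s i\<close>, so the
      level-\<open>k\<close> bound holds along the tail of the subsequence.\<close>
    moreover have "\<forall>\<^sub>F i in sequentially. ((X (s i), U (s i)), r (s i)) \<in> {(p, r). f k p \<le> ereal r}"
      using le seq_suble[OF s] by (auto simp: eventually_sequentially intro!: exI[of _ k])
        (meson le order_trans)
    ultimately have "((x, u), r0) \<in> {(p, r). f k p \<le> ereal r}"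
      by (intro Lim_in_closed_set[OF lsc[unfolded lsc_def] _ sequentially_bot])
    then show ?thesis by simp
  qed
  then show ?thesis by blast
qed

text \<open>Direct method with near-minimizers of tolerance \<open>1 / (i + 1)\<close>. At value
  \<open>\<infinity>\<close> every input attains the infimum, and the lower bound
  \<open>- h x\<close> excludes \<open>-\<infinity>\<close>.\<close>

lemma coercive_INF_attained:
  fixes f :: "'a::metric_space \<times> 'b::euclidean_space \<Rightarrow> ereal"
  assumes "lsc f" "continuous_on UNIV h" "c > 0"
    and coercive: "\<And>x u. ereal (c * (norm u)\<^sup>2 - h x) \<le> f (x, u)"
  obtains u where "f (x, u) = (INF u. f (x, u))"
proof (cases "INF u. f (x, u)")
  case (real a)
  have "\<exists>u. f (x, u) < ereal (a + 1 / real (Suc i))" for i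
  proof -
    have "(INF u. f (x, u)) < ereal (a + 1 / real (Suc i))"
      by (simp add: real)
    then show ?thesis by (auto simp: INF_less_iff)
  qed
  then obtain U where U: "\<And>i. f (x, U i) < ereal (a + 1 / real (Suc i))"
    by metis
  have "(\<lambda>i. a + 1 / real (Suc i)) \<longlonglongrightarrow> a + 0"
    by (intro tendsto_intros LIMSEQ_inverse_real_of_nat[unfolded inverse_eq_divide])
  then have "(\<lambda>i. a + 1 / real (Suc i)) \<longlonglongrightarrow> a" by simp
  from coercive_limit[OF assms(1-3) coercive tendsto_const this less_imp_le[OF U]]
  obtain u where "f (x, u) \<le> ereal a" by metis
  then have "f (x, u) = (INF u. f (x, u))"
    using real by (metis INF_lower UNIV_I antisym)
  then show thesis by (rule that)
next
  case PInf
  then have "f (x, 0) = (INF u. f (x, u))"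
    by (metis INF_lower UNIV_I ereal_infty_less_eq(1))
  then show thesis by (rule that)
next
  case MInf
  have "ereal (- h x) \<le> f (x, u)" for u
    using order_trans[OF _ coercive[of u x], of "ereal (- h x)"] assms(3) by simp
  then have "ereal (- h x) \<le> (INF u. f (x, u))"
    by (rule INF_greatest)
  with MInf show thesis by simp
qed

text \<open>Along a convergent sequence in the epigraph of the infimum the minimizers stay bounded,
  because \<open>h\<close> is continuous; a limit point of them certifies the limit.\<close>

lemma lsc_coercive_INF:
  fixes f :: "'a::metric_space \<times> 'b::euclidean_space \<Rightarrow> ereal"
  assumes "lsc f" "continuous_on UNIV h" "c > 0"
    and coercive: "\<And>x u. ereal (c * (norm u)\<^sup>2 - h x) \<le> f (x, u)"
  shows "lsc (\<lambda>x. INF u. f (x, u))"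
  unfolding lsc_def closed_sequential_limits
proof (intro allI impI, elim conjE)
  fix p and l :: "'a \<times> real"
  assume p: "\<forall>n. p n \<in> {(x, r). (INF u. f (x, u)) \<le> ereal r}" and l: "p \<longlonglongrightarrow> l"
  have "\<exists>u. f (fst (p n), u) \<le> ereal (snd (p n))" for n
  proof -
    have "(INF u. f (fst (p n), u)) \<le> ereal (snd (p n))"
      using p[rule_format, of n] by (simp add: case_prod_beta)
    moreover obtain u where "f (fst (p n), u) = (INF u. f (fst (p n), u))"
      using coercive_INF_attained[OF assms] .
    ultimately show ?thesis by metis
  qed
  then obtain U where U: "\<And>n. f (fst (p n), U n) \<le> ereal (snd (p n))"
    by metis
  from coercive_limit[OF assms tendsto_fst[OF l] tendsto_snd[OF l] U]
  obtain u where "f (fst l, u) \<le> ereal (snd l)" by metis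
  then show "l \<in> {(x, r). (INF u. f (x, u)) \<le> ereal r}"
    by (auto simp: case_prod_beta intro: INF_lower2)
qed

section \<open>The quadratic forms of the problem\<close>

lemma continuous_on_wnorm2 [continuous_intros]:
  assumes "continuous_on S f"
  shows "continuous_on S (\<lambda>x. wnorm2 P (f x))"
  unfolding wnorm2_def
  by (intro continuous_intros assms
      bounded_linear.continuous_on[OF matrix_vector_mul_bounded_linear])

lemma wnorm2_scaleR: "wnorm2 P (a *\<^sub>R x) = a\<^sup>2 * wnorm2 P x"
  by (simp add: wnorm2_def matrix_vector_mult_scaleR power2_eq_square)

lemma wnorm2_0 [simp]: "wnorm2 P 0 = 0"
  by (simp add: wnorm2_def)

lemma sym_pos_def_nonneg: "sym_pos_def P \<Longrightarrow> 0 \<le> wnorm2 P x"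
  by (cases "x = 0") (auto simp: sym_pos_def_def wnorm2_def less_imp_le)

text \<open>\<open>c\<close> is the minimum of the form on the unit sphere; homogeneity of degree
  two extends the bound.\<close>

lemma sym_pos_def_coercive:
  fixes P :: "real^'a^'a"
  assumes "sym_pos_def P"
  obtains c where "c > 0" "\<And>x. c * (norm x)\<^sup>2 \<le> wnorm2 P x"
proof -
  have "norm (axis undefined 1 :: real^'a) = 1"
    by simp
  then have "sphere 0 1 \<noteq> ({} :: (real^'a) set)"
    by (metis mem_sphere_0 empty_iff)
  then obtain y :: "real^'a" where y: "y \<in> sphere 0 1" "\<And>x. x \<in> sphere 0 1 \<Longrightarrow> wnorm2 P y \<le> wnorm2 P x"
    using continuous_attains_inf[of "sphere (0::real^'a) 1" "wnorm2 P"]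
      continuous_on_wnorm2[OF continuous_on_id] by (metis compact_sphere)
  have "wnorm2 P y > 0"
    using assms y(1) unfolding sym_pos_def_def wnorm2_def
    by (metis mem_sphere_0 norm_zero zero_neq_one)
  moreover have "wnorm2 P y * (norm x)\<^sup>2 \<le> wnorm2 P x" for x
  proof (cases "x = 0")
    case False
    have "wnorm2 P x = (norm x)\<^sup>2 * wnorm2 P (x /\<^sub>R norm x)"
      using False by (simp add: wnorm2_scaleR power_inverse field_simps)
    moreover have "x /\<^sub>R norm x \<in> sphere 0 1"
      using False by simp
    ultimately show ?thesis
      using mult_left_mono[OF y(2), of "x /\<^sub>R norm x" "(norm x)\<^sup>2"]
      by (simp only: mult.commute zero_le_power2)
  qed simp
  ultimately show thesis by (rule that)
qed

text \<open>For accumulated data \<open>Z\<close> this is the total squared disturbance that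
  \<open>(A, B)\<close> needs to explain the data; see \<open>misfit_data_mat\<close>.\<close>

abbreviation misfit :: "real^'n^'n \<Rightarrow> real^'m^'n \<Rightarrow> ('n::finite, 'm::finite) blockmat \<Rightarrow> real" where
  "misfit A B Z \<equiv> mat_wnorm2 Z (transpose (block_row A B))"

text \<open>Makes linearity in \<open>Z\<close> and polynomial dependence on the model
  visible.\<close>

lemma misfit_eq:
  "misfit A B Z = (\<Sum>i\<in>UNIV. \<Sum>k\<in>UNIV. \<Sum>j\<in>UNIV.
      block_row A B $ i $ j * Z $ j $ k * block_row A B $ i $ k)"
  by (simp add: mat_wnorm2_def trace_def matrix_matrix_mult_def transpose_def sum_distrib_right)

lemma misfit_add: "misfit A B (Y + Z) = misfit A B Y + misfit A B Z"
  by (simp add: misfit_eq algebra_simps sum.distrib)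

lemma misfit_0 [simp]: "misfit A B 0 = 0"
  by (simp add: misfit_eq)

lemma misfit_sum: "misfit A B (\<Sum>i\<in>I. Z i) = (\<Sum>i\<in>I. misfit A B (Z i))"
  by (induction I rule: infinite_finite_induct) (auto simp: misfit_add)

lemma continuous_on_misfit_data: "continuous_on S (misfit A B)"
  unfolding misfit_eq by (intro continuous_intros)

lemma sum_sum_cases: "(\<exists>k. i = Inl k) \<or> (\<exists>k. i = Inr (Inl k)) \<or> (\<exists>k. i = Inr (Inr k))"
  by (metis sum.exhaust)

lemma continuous_on_misfit_model: "continuous_on S (\<lambda>(A, B). misfit A B Z)"
proof -
  have "continuous_on S (\<lambda>p. block_row (fst p) (snd p) $ i $ j)" for i j
    using sum_sum_cases[of j] by (auto simp: block_row_def intro!: continuous_intros)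
  then show ?thesis
    unfolding misfit_eq case_prod_beta
    by (intro continuous_on_sum continuous_on_mult continuous_on_const)
qed

lemma block_row_mult_block_col:
  "block_row A B *v block_col a b c = a + A *v b + B *v c"
proof -
  have UNIV_sum: "(\<Sum>j\<in>UNIV. f j) = (\<Sum>k\<in>UNIV. f (Inl k)) + (\<Sum>k\<in>UNIV. f (Inr k))"
    for f :: "'x::finite + 'y::finite \<Rightarrow> real"
    using sum.Plus[of "UNIV::'x set" "UNIV::'y set" f] by (simp add: o_def)
  show ?thesis
    by (simp add: vec_eq_iff matrix_vector_mult_def block_row_def block_col_def UNIV_sum
        mat_def if_distrib[of "\<lambda>t. t * _"] cong: if_cong)
qed

lemma misfit_outer: "misfit A B (outer z) = (norm (block_row A B *v z))\<^sup>2"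
  unfolding misfit_eq power2_norm_eq_inner
  by (simp add: inner_vec_def outer_def matrix_vector_mult_def sum_product sum_distrib_left
      sum_distrib_right mult_ac)

text \<open>The link between the two problems: \<open>v - A *v x - B *v u\<close> is the disturbance
  that leads from \<open>x\<close> to \<open>v\<close> under the model
  \<open>(A, B)\<close>.\<close>

lemma misfit_outer_block_col:
  "misfit A B (outer (block_col (- v) x u)) = (norm (v - A *v x - B *v u))\<^sup>2"
proof -
  have "- v + A *v x + B *v u = - (v - A *v x - B *v u)"
    by simp
  then show ?thesis
    unfolding misfit_outer block_row_mult_block_col by (metis norm_minus_cancel)
qed

text \<open>The trace is the sum of the values of the form \<open>Z\<close> at the rows of
  \<open>block_row A B\<close>.\<close>

lemma misfit_nonneg:
  assumes "Z \<in> sym_psd"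
  shows "0 \<le> misfit A B Z"
proof -
  have "misfit A B Z = (\<Sum>i\<in>UNIV. block_row A B $ i \<bullet> (Z *v (block_row A B $ i)))"
    unfolding misfit_eq inner_vec_def matrix_vector_mult_def
    by (subst sum.swap) (simp add: sum_distrib_left mult_ac)
  then show ?thesis
    using assms by (simp add: sym_psd_def sum_nonneg)
qed

section \<open>Data matrices: positive semidefiniteness and continuity\<close>

lemma sym_psd_0: "0 \<in> sym_psd"
  by (simp add: sym_psd_def transpose_def vec_eq_iff)

lemma sym_psd_add:
  assumes "Y \<in> sym_psd" "Z \<in> sym_psd"
  shows "Y + Z \<in> sym_psd"
  using assms
  by (simp add: sym_psd_def matrix_vector_mult_add_rdistrib inner_add_right)
    (simp add: transpose_def vec_eq_iff)

lemma sym_psd_outer: "outer z \<in> sym_psd"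
proof -
  have "x \<bullet> (outer z *v x) = (x \<bullet> z)\<^sup>2" for x
    by (simp add: inner_vec_def outer_def matrix_vector_mult_def power2_eq_square sum_product
        sum_distrib_left mult_ac)
  then show ?thesis
    by (simp add: sym_psd_def) (simp add: transpose_def outer_def vec_eq_iff mult.commute)
qed

lemma continuous_on_outer [continuous_intros]:
  assumes "continuous_on S f"
  shows "continuous_on S (\<lambda>x. outer (f x))"
  unfolding outer_def by (intro continuous_intros assms)

lemma continuous_on_block_col [continuous_intros]:
  assumes "continuous_on S f" "continuous_on S g" "continuous_on S h"
  shows "continuous_on S (\<lambda>x. block_col (f x) (g x) (h x))"
  unfolding block_col_def
proof (intro continuous_on_vec_lambda)
  fix i :: "'b + 'b + 'c"
  show "continuous_on S (\<lambda>x. case i of Inl k \<Rightarrow> f x $ k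
      | Inr (Inl k) \<Rightarrow> g x $ k | Inr (Inr k) \<Rightarrow> h x $ k)"
    using sum_sum_cases[of i] by (auto intro!: continuous_intros assms)
qed


section \<open>Value iteration\<close>

locale minimax_problem =
  fixes Q :: "real^'n^'n" and R :: "real^'m^'m" and \<gamma> :: real
    and M :: "((real^'n^'n) \<times> (real^'m^'n)) set"
  assumes Q: "sym_pos_def Q" and R: "sym_pos_def R"
    and M_nonempty: "M \<noteq> {}" and M_compact: "compact M"
    and \<gamma>: "\<gamma> > 0"
begin

abbreviation V :: "nat \<Rightarrow> ('n, 'm) value_fun" where
  "V \<equiv> value_iter Q R \<gamma> M"

text \<open>A supremum instead of a limit, so that it is meaningful without any boundedness;
  \<open>value_lim_eq\<close> identifies the two.\<close>

definition V_sup :: "('n, 'm) value_fun" where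
  "V_sup x Z = (SUP k. V k x Z)"

abbreviation stage :: "real^'n \<Rightarrow> real^'m \<Rightarrow> real" where
  "stage x u \<equiv> wnorm2 Q x + wnorm2 R u"

lemma stage_nonneg: "0 \<le> stage x u"
  by (simp add: Q R sym_pos_def_nonneg)

text \<open>A real infimum is a lower bound only over a set bounded below; compactness of
  \<open>M\<close> and continuity in the model provide this.\<close>

lemma min_misfit_le:
  assumes "(A, B) \<in> M"
  shows "min_misfit M Z \<le> misfit A B Z"
proof -
  have "compact ((\<lambda>(A, B). misfit A B Z) ` M)"
    by (intro compact_continuous_image continuous_on_misfit_model M_compact)
  then have "bdd_below ((\<lambda>(A, B). misfit A B Z) ` M)"
    by (intro bounded_imp_bdd_below compact_imp_bounded)
  from cINF_lower[OF this assms] show ?thesis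
    by (simp add: min_misfit_def)
qed

text \<open>Replaces the real infimum by an extended-real supremum, which commutes with adding
  constants and preserves lower semicontinuity.\<close>

lemma V_0_eq: "V 0 x Z = (SUP (A, B)\<in>M. ereal (- \<gamma>\<^sup>2 * misfit A B Z))"
proof (rule antisym)
  show "(SUP (A, B)\<in>M. ereal (- \<gamma>\<^sup>2 * misfit A B Z)) \<le> V 0 x Z"
    by (auto intro!: SUP_least mult_left_mono min_misfit_le)
  show "V 0 x Z \<le> (SUP (A, B)\<in>M. ereal (- \<gamma>\<^sup>2 * misfit A B Z))"
  proof (rule dense_le)
    fix c assume c: "c < V 0 x Z"
    show "c \<le> (SUP (A, B)\<in>M. ereal (- \<gamma>\<^sup>2 * misfit A B Z))"
    proof (cases c)
      case (real a)
      then have "min_misfit M Z < - a / \<gamma>\<^sup>2"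
        using c \<gamma> by (simp add: field_simps)
      then have "\<exists>p\<in>M. (\<lambda>(A, B). misfit A B Z) p < - a / \<gamma>\<^sup>2"
        using cInf_lessD[of "(\<lambda>(A, B). misfit A B Z) ` M"] M_nonempty
        unfolding min_misfit_def by blast
      then obtain A B where AB: "(A, B) \<in> M" "misfit A B Z < - a / \<gamma>\<^sup>2"
        by auto
      then have "c \<le> ereal (- \<gamma>\<^sup>2 * misfit A B Z)"
        using \<gamma> by (simp add: real field_simps)
      then show ?thesis
        using AB(1) by (intro SUP_upper2[of "(A, B)"]) auto
    qed (use c in auto)
  qed
qed

text \<open>The choice \<open>v = A *v x + B *v u\<close> is the disturbance-free successor and
  leaves the misfit of \<open>(A, B)\<close> unchanged.\<close>

lemma bellman_u_V_0_ge:
  assumes "(A, B) \<in> M"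
  shows "ereal (stage x u - \<gamma>\<^sup>2 * misfit A B Z) \<le> bellman_u Q R u (V 0) x Z"
proof -
  let ?Z = "Z + outer (block_col (- (A *v x + B *v u)) x u)"
  have "misfit A B ?Z = misfit A B Z"
    unfolding misfit_add misfit_outer_block_col by simp
  then have "\<gamma>\<^sup>2 * min_misfit M ?Z \<le> \<gamma>\<^sup>2 * misfit A B Z"
    using min_misfit_le[OF assms, of ?Z] by (simp add: mult_left_mono)
  then show ?thesis
    unfolding bellman_u_def by (intro SUP_upper2[of "A *v x + B *v u"]) auto
qed

lemma bellman_u_mono:
  "(\<And>v Z. W v Z \<le> W' v Z) \<Longrightarrow> bellman_u Q R u W x Z \<le> bellman_u Q R u W' x Z"
  unfolding bellman_u_def by (intro SUP_mono' add_left_mono)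

lemma bellman_mono:
  "(\<And>v Z. W v Z \<le> W' v Z) \<Longrightarrow> bellman Q R W x Z \<le> bellman Q R W' x Z"
  unfolding bellman_def by (intro INF_mono' bellman_u_mono)

text \<open>At level 0 each model can continue without disturbance while the stage cost is
  nonnegative; monotonicity of the operator does the rest.\<close>

lemma V_le_Suc: "V k x Z \<le> V (Suc k) x Z"
proof (induction k arbitrary: x Z)
  case 0
  have "ereal (- \<gamma>\<^sup>2 * misfit A B Z) \<le> bellman_u Q R u (V 0) x Z" if "(A, B) \<in> M" for A B u
    using stage_nonneg[of x u] by (intro order_trans[OF _ bellman_u_V_0_ge[OF that]]) simp
  then have "V 0 x Z \<le> bellman Q R (V 0) x Z"
    unfolding V_0_eq bellman_def case_prod_beta by (intro SUP_least INF_greatest) simp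
  then show ?case by simp
next
  case (Suc k)
  then show ?case by (simp add: bellman_mono)
qed

lemma incseq_V: "incseq (\<lambda>k. V k x Z)"
  by (intro incseq_SucI V_le_Suc)

lemma V_le_V_sup: "V k x Z \<le> V_sup x Z"
  unfolding V_sup_def by (rule SUP_upper) simp

lemma value_lim_eq: "value_lim Q R \<gamma> M = V_sup"
  unfolding value_lim_def V_sup_def by (intro ext limI LIMSEQ_SUP incseq_V)

lemma V_sup_lower: "- \<infinity> < V_sup x Z"
  using V_le_V_sup[of 0 x Z] by auto

text \<open>For a fixed input the suprema over \<open>v\<close> and \<open>k\<close> commute.
  Exchanging with the infimum over inputs is what requires compactness.\<close>

lemma bellman_u_V_sup: "bellman_u Q R u V_sup x Z = (SUP k. bellman_u Q R u (V k) x Z)"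
proof -
  have "ereal a + V_sup v Y = (SUP k. ereal a + V k v Y)" for a v Y
    unfolding V_sup_def by (subst SUP_ereal_add_right) auto
  then show ?thesis
    unfolding bellman_u_def by (simp only:) (rule SUP_commute)
qed

section \<open>Regularity of the iterates, attained minima and dependence on the data\<close>

lemma lsc_bellman_u:
  assumes "lsc (\<lambda>p. W (fst p) (snd p))"
  shows "lsc (\<lambda>(p, u). bellman_u Q R u W (fst p) (snd p))"
proof -
  have "lsc (\<lambda>y. W v (snd (fst y) + outer (block_col (- v) (fst (fst y)) (snd y))))" for v
    by (rule lsc_compose[OF assms,
          of "\<lambda>y. (v, snd (fst y) + outer (block_col (- v) (fst (fst y)) (snd y)))", simplified])
      (intro continuous_intros)
  then show ?thesis
    unfolding bellman_u_def case_prod_beta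
    by (intro lsc_SUP lsc_add_continuous continuous_intros)
qed

text \<open>Any fixed model gives the bound: its disturbance-free response leaves the input cost,
  which dominates \<open>c * (norm u)^2\<close>, minus a misfit continuous in the data. As the
  iterates increase, the bound for \<open>V 0\<close> serves all \<open>k\<close>.\<close>

lemma bellman_u_V_coercive:
  obtains c h where "c > 0" "continuous_on UNIV h"
    "\<And>k p u. ereal (c * (norm u)\<^sup>2 - h p) \<le> bellman_u Q R u (V k) (fst p) (snd p)"
proof -
  obtain A B where AB: "(A, B) \<in> M"
    using M_nonempty by auto
  obtain c where c: "c > 0" "\<And>u. c * (norm u)\<^sup>2 \<le> wnorm2 R u"
    using sym_pos_def_coercive[OF R] by metis
  have "ereal (c * (norm u)\<^sup>2 - \<gamma>\<^sup>2 * misfit A B (snd p))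
      \<le> bellman_u Q R u (V k) (fst p) (snd p)" for k p u
  proof -
    have "ereal (c * (norm u)\<^sup>2 - \<gamma>\<^sup>2 * misfit A B (snd p))
        \<le> ereal (stage (fst p) u - \<gamma>\<^sup>2 * misfit A B (snd p))"
      using c(2)[of u] sym_pos_def_nonneg[OF Q, of "fst p"] by simp
    also have "\<dots> \<le> bellman_u Q R u (V 0) (fst p) (snd p)"
      by (rule bellman_u_V_0_ge[OF AB])
    also have "\<dots> \<le> bellman_u Q R u (V k) (fst p) (snd p)"
      by (intro bellman_u_mono incseqD[OF incseq_V]) simp
    finally show ?thesis .
  qed
  moreover have "continuous_on UNIV (\<lambda>p. \<gamma>\<^sup>2 * misfit A B (snd p))"
    by (intro continuous_intros continuous_on_compose2[OF continuous_on_misfit_data[of UNIV]]) auto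
  ultimately show thesis
    using that c(1) by blast
qed

text \<open>\<open>V 0\<close> is a supremum of continuous functions; in the step, coercivity makes
  lower semicontinuity survive the infimum over inputs.\<close>

lemma lsc_V: "lsc (\<lambda>p. V k (fst p) (snd p))"
proof (induction k)
  case 0
  have "lsc (\<lambda>p :: (real^'n) \<times> ('n, 'm) blockmat. ereal (- \<gamma>\<^sup>2 * misfit A B (snd p)))" for A B
  proof -
    have "closed {p :: ((real^'n) \<times> ('n, 'm) blockmat) \<times> real.
        - \<gamma>\<^sup>2 * misfit A B (snd (fst p)) \<le> snd p}"
      by (intro closed_Collect_le continuous_intros
          continuous_on_compose2[OF continuous_on_misfit_data[of UNIV]]) auto
    then show ?thesis
      unfolding lsc_def ereal_less_eq case_prod_beta' .
  qed
  then show ?case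
    unfolding V_0_eq case_prod_beta by (rule lsc_SUP)
next
  case (Suc k)
  obtain c h where ch: "c > 0" "continuous_on UNIV h"
    "\<And>k p u. ereal (c * (norm u)\<^sup>2 - h p) \<le> bellman_u Q R u (V k) (fst p) (snd p)"
    using bellman_u_V_coercive by blast
  show ?case
    using lsc_coercive_INF[OF lsc_bellman_u[OF Suc] ch(2,1)] ch(3)
    by (simp add: bellman_def)
qed

text \<open>The optimal inputs of the single iterates stay in a compact set, and any of their limit
  points is optimal for the supremum of the iterates.\<close>

lemma
  shows bellman_V_sup: "bellman Q R V_sup x Z = V_sup x Z"
    and V_sup_minimizer: "\<exists>u. bellman_u Q R u V_sup x Z = V_sup x Z"
proof -
  have ge: "V_sup x Z \<le> bellman Q R V_sup x Z"
  proof -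
    have "V k x Z \<le> bellman Q R V_sup x Z" for k
    proof -
      have "V k x Z \<le> bellman Q R (V k) x Z"
        using V_le_Suc[of k x Z] by simp
      also have "\<dots> \<le> bellman Q R V_sup x Z"
        by (intro bellman_mono V_le_V_sup)
      finally show ?thesis .
    qed
    then show ?thesis
      unfolding V_sup_def[of x Z] by (intro SUP_least)
  qed
  have "\<exists>u. bellman_u Q R u V_sup x Z \<le> V_sup x Z"
  proof (cases "V_sup x Z")
    case (real r)
    define f where "f k = (\<lambda>(p, u). bellman_u Q R u (V k) (fst p) (snd p))" for k
    obtain c h where ch: "c > 0" "continuous_on UNIV h"
      "\<And>k p u. ereal (c * (norm u)\<^sup>2 - h p) \<le> f k (p, u)"
      unfolding f_def using bellman_u_V_coercive by auto
    have lsc: "lsc (f k)" for k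
      unfolding f_def by (rule lsc_bellman_u[OF lsc_V])
    have "\<exists>u. f k ((x, Z), u) \<le> ereal r" for k
    proof -
      obtain u where "f k ((x, Z), u) = (INF u. f k ((x, Z), u))"
        using coercive_INF_attained[OF lsc ch(2,1,3)] .
      then have "f k ((x, Z), u) = V (Suc k) x Z"
        by (simp add: f_def bellman_def)
      then show ?thesis
        using V_le_V_sup[of "Suc k" x Z] real by metis
    qed
    then obtain U where U: "\<And>k. f k ((x, Z), U k) \<le> ereal r"
      by metis
    \<comment> \<open>The iterates increase, so a good input for a later one is also good for all
      earlier ones.\<close>
    have U_le: "f k ((x, Z), U i) \<le> ereal r" if "k \<le> i" for k i
    proof -
      have "f k ((x, Z), U i) \<le> f i ((x, Z), U i)"
        unfolding f_def prod.case by (intro bellman_u_mono incseqD[OF incseq_V] that)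
      then show ?thesis
        using U order_trans by blast
    qed
    obtain u where "\<forall>k. f k ((x, Z), u) \<le> ereal r"
      using coercive_limit[where f=f and U=U, OF lsc ch(2,1,3) tendsto_const tendsto_const U_le] ..
    then have "bellman_u Q R u V_sup x Z \<le> ereal r"
      unfolding bellman_u_V_sup by (intro SUP_least) (simp add: f_def)
    then show ?thesis
      by (auto simp: real)
  \<comment> \<open>At value \<open>\<infinity>\<close> any input works, and
    \<open>-\<infinity>\<close> does not occur.\<close>
  qed (use V_sup_lower[of x Z] in auto)
  then obtain u where u: "bellman_u Q R u V_sup x Z \<le> V_sup x Z" ..
  have "bellman Q R V_sup x Z \<le> bellman_u Q R u V_sup x Z"
    unfolding bellman_def by (rule INF_lower) simp
  with u ge have "bellman Q R V_sup x Z = V_sup x Z" "bellman_u Q R u V_sup x Z = V_sup x Z"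
    by order+
  then show "bellman Q R V_sup x Z = V_sup x Z" "\<exists>u. bellman_u Q R u V_sup x Z = V_sup x Z"
    by blast+
qed

text \<open>Additional data can only raise the misfit of each model. This carries bounds from
  \<open>Z = 0\<close> to all of \<open>sym_psd\<close>.\<close>

lemma V_antimono:
  assumes "Y \<in> sym_psd"
  shows "V k x (Z + Y) \<le> V k x Z"
proof (induction k arbitrary: x Z)
  case 0
  show ?case
    unfolding V_0_eq
    using \<gamma> misfit_nonneg[OF assms] by (auto intro!: SUP_mono' simp: misfit_add)
next
  case (Suc k)
  have "V k v (Z + Y + X) \<le> V k v (Z + X)" for v X
    using Suc[of v "Z + X"] by (simp add: add_ac)
  then have "bellman_u Q R u (V k) x (Z + Y) \<le> bellman_u Q R u (V k) x Z" for u
    unfolding bellman_u_def by (intro SUP_mono' add_left_mono)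
  then show ?case
    unfolding value_iter.simps bellman_def by (rule INF_mono')
qed

section \<open>Verification, adversary and equality of the two problems\<close>

text \<open>By the Bellman inequality the accumulated cost plus the current \<open>W\<close> stays
  below \<open>W x0 0\<close>, and at the horizon \<open>W\<close> dominates the penalty
  \<open>V 0\<close>. It serves both \<open>V_sup\<close> and an arbitrary supersolution.\<close>

lemma verification:
  assumes super: "\<And>x Z. Z \<in> sym_psd \<Longrightarrow> V 0 x Z \<le> W x Z \<and> bellman_u Q R (\<eta> x Z) W x Z \<le> W x Z"
  shows "G_cost Q R \<gamma> M \<eta> x0 \<le> W x0 0"
  unfolding G_cost_def
proof (intro Sup_least, clarify)
  fix v N x Z u
  assume tr: "data_trajectory \<eta> x0 v x Z u"
  have eqs: "x 0 = x0" "Z 0 = 0" "x (Suc t) = v t" "u t = \<eta> (x t) (Z t)"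
    "Z (Suc t) = Z t + outer (block_col (- x (Suc t)) (x t) (u t))" for t
    using tr by (auto simp: data_trajectory_def)
  have psd: "Z t \<in> sym_psd" for t
    by (induction t) (auto simp: eqs(2,5) sym_psd_0 intro: sym_psd_add sym_psd_outer)
  have main: "ereal (\<Sum>t<j. stage (x t) (u t)) + W (x j) (Z j) \<le> W x0 0" for j
  proof (induction j)
    case 0
    then show ?case by (simp add: eqs(1,2))
  next
    case (Suc j)
    have "ereal (\<Sum>t<Suc j. stage (x t) (u t)) + W (x (Suc j)) (Z (Suc j))
        = ereal (\<Sum>t<j. stage (x t) (u t)) + (ereal (stage (x j) (u j)) + W (x (Suc j)) (Z (Suc j)))"
      by (simp add: plus_ereal.simps(1)[symmetric] add.assoc del: plus_ereal.simps)
    also have "ereal (stage (x j) (u j)) + W (x (Suc j)) (Z (Suc j)) \<le> bellman_u Q R (u j) W (x j) (Z j)"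
      unfolding bellman_u_def eqs(5)[of j] by (rule SUP_upper) simp
    also have "\<dots> \<le> W (x j) (Z j)"
      unfolding eqs(4) using super[OF psd] ..
    also have "ereal (\<Sum>t<j. stage (x t) (u t)) + W (x j) (Z j) \<le> W x0 0"
      by (rule Suc.IH)
    finally show ?case
      by (simp add: add_left_mono)
  qed
  \<comment> \<open>Horizon \<open>N\<close> comprises \<open>N + 1\<close> stages, and its penalty
    is \<open>V 0\<close> at time \<open>N + 1\<close>.\<close>
  have "ereal ((\<Sum>t=0..N. stage (x t) (u t)) - \<gamma>\<^sup>2 * min_misfit M (Z (N + 1)))
      = ereal (\<Sum>t<Suc N. stage (x t) (u t)) + V 0 (x (Suc N)) (Z (Suc N))"
    by (simp add: atLeast0AtMost lessThan_Suc_atMost)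
  also have "\<dots> \<le> ereal (\<Sum>t<Suc N. stage (x t) (u t)) + W (x (Suc N)) (Z (Suc N))"
    by (intro add_left_mono conjunct1[OF super[OF psd]])
  also have "\<dots> \<le> W x0 0"
    by (rule main)
  finally show "ereal ((\<Sum>t=0..N. stage (x t) (u t)) - \<gamma>\<^sup>2 * min_misfit M (Z (N + 1))) \<le> W x0 0" .
qed

section \<open>Feedbacks as history-dependent laws\<close>

definition data_mat :: "(nat \<Rightarrow> real^'n) \<Rightarrow> (nat \<Rightarrow> real^'m) \<Rightarrow> nat \<Rightarrow> ('n, 'm) blockmat" where
  "data_mat x u t = (\<Sum>\<tau><t. outer (block_col (- x (Suc \<tau>)) (x \<tau>) (u \<tau>)))"

lemma misfit_data_mat:
  "misfit A B (data_mat x u t) = (\<Sum>\<tau><t. (norm (x (Suc \<tau>) - A *v x \<tau> - B *v u \<tau>))\<^sup>2)"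
  by (simp add: data_mat_def misfit_sum misfit_outer_block_col)

text \<open>A trajectory of a model is a data trajectory with \<open>v t = x (Suc t)\<close>, and
  its disturbance penalty is the misfit of that model, hence at least the minimal one.\<close>

lemma J_cost_induced_le: "J_cost Q R \<gamma> M (induced_law \<eta>) x0 \<le> G_cost Q R \<gamma> M \<eta> x0"
  unfolding J_cost_def
proof (intro Sup_least, clarify)
  fix w A B N x u
  assume AB: "(A, B) \<in> M" and tr: "trajectory A B (induced_law \<eta>) x0 w x u"
  have u: "u t = \<eta> (x t) (data_mat x u t)" for t
  proof -
    have "u t = induced_law \<eta> t (map x [0..<Suc t]) (map u [0..<t])"
      using tr unfolding trajectory_def by blast
    \<comment> \<open>All list positions read are in range, since \<open>\<tau> < t\<close> gives
      \<open>Suc \<tau> \<le> t\<close>.\<close>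
    also have "\<dots> = \<eta> (x t) (data_mat x u t)"
      unfolding induced_law_def data_mat_def
      by (rule arg_cong2[of _ _ _ _ \<eta>]) (auto intro!: sum.cong simp del: upt_Suc)
    finally show ?thesis .
  qed
  have "data_mat x u 0 = 0"
    and "data_mat x u (Suc t) = data_mat x u t + outer (block_col (- x (Suc t)) (x t) (u t))" for t
    by (simp_all add: data_mat_def)
  moreover have "x 0 = x0"
    using tr unfolding trajectory_def by blast
  ultimately have data: "data_trajectory \<eta> x0 (\<lambda>t. x (Suc t)) x (data_mat x u) u"
    unfolding data_trajectory_def using u by blast
  have "x (Suc t) = A *v x t + B *v u t + w t" for t
    using tr unfolding trajectory_def by blast
  then have "w t = x (Suc t) - A *v x t - B *v u t" for t
    by simp
  then have "(\<Sum>t<Suc N. (norm (w t))\<^sup>2) = misfit A B (data_mat x u (Suc N))"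
    by (simp add: misfit_data_mat)
  then have "\<gamma>\<^sup>2 * min_misfit M (data_mat x u (N + 1)) \<le> \<gamma>\<^sup>2 * (\<Sum>t<Suc N. (norm (w t))\<^sup>2)"
    using min_misfit_le[OF AB] by (simp add: mult_left_mono)
  then have "ereal (\<Sum>t=0..N. stage (x t) (u t) - \<gamma>\<^sup>2 * (norm (w t))\<^sup>2)
      \<le> ereal ((\<Sum>t=0..N. stage (x t) (u t)) - \<gamma>\<^sup>2 * min_misfit M (data_mat x u (N + 1)))"
    by (simp add: sum_subtractf sum_distrib_left atLeast0AtMost lessThan_Suc_atMost)
  also have "\<dots> \<le> G_cost Q R \<gamma> M \<eta> x0"
    unfolding G_cost_def
    by (intro Sup_upper CollectI exI[of _ "\<lambda>t. x (Suc t)"] exI[of _ N] exI[of _ x]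
        exI[of _ "data_mat x u"] exI[of _ u] conjI refl data)
  finally show "ereal (\<Sum>t=0..N. stage (x t) (u t) - \<gamma>\<^sup>2 * (norm (w t))\<^sup>2) \<le> G_cost Q R \<gamma> M \<eta> x0" .
qed

section \<open>The adversary against an arbitrary law\<close>

primrec input_history :: "('n, 'm) control_law \<Rightarrow> (nat \<Rightarrow> real^'n) \<Rightarrow> nat \<Rightarrow> (real^'m) list" where
  "input_history \<mu> x 0 = []"
| "input_history \<mu> x (Suc t) = input_history \<mu> x t @ [\<mu> t (map x [0..<Suc t]) (input_history \<mu> x t)]"

text \<open>Inputs as a function of the states alone, so that states can be fixed before any model
  or disturbance.\<close>

definition law_input :: "('n, 'm) control_law \<Rightarrow> (nat \<Rightarrow> real^'n) \<Rightarrow> nat \<Rightarrow> real^'m" where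
  "law_input \<mu> x t = \<mu> t (map x [0..<Suc t]) (input_history \<mu> x t)"

lemma input_history_eq: "input_history \<mu> x t = map (law_input \<mu> x) [0..<t]"
  by (induction t) (simp_all add: law_input_def)

text \<open>Causality: altering a later state leaves earlier inputs intact.\<close>

lemma law_input_cong:
  assumes "\<And>s. s \<le> t \<Longrightarrow> x s = y s"
  shows "law_input \<mu> x t = law_input \<mu> y t"
  using assms
proof (induction t rule: less_induct)
  case (less t)
  have "map x [0..<Suc t] = map y [0..<Suc t]"
    using less.prems by (intro map_cong) auto
  moreover have "input_history \<mu> x t = input_history \<mu> y t"
    unfolding input_history_eq using less by (intro map_cong) auto
  ultimately show ?case
    by (simp only: law_input_def)
qed

text \<open>Against any law the disturbance can be chosen one step at a time so that the value-to-go
  never falls below the prescribed level.\<close>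

lemma adversary:
  assumes "c < V (j + k) x0 0"
  shows "\<exists>x. x 0 = x0 \<and> c < ereal (\<Sum>t<j. stage (x t) (law_input \<mu> x t))
      + V k (x j) (data_mat x (law_input \<mu> x) j)"
  using assms
proof (induction j arbitrary: k)
  case 0
  then show ?case
    by (intro exI[of _ "\<lambda>_. x0"]) (simp add: data_mat_def)
next
  case (Suc j)
  \<comment> \<open>As \<open>j + Suc k = Suc j + k\<close>, the hypothesis leaves one Bellman step
    to spend at time \<open>j\<close>.\<close>
  from Suc.IH[of "Suc k"] Suc.prems obtain x where x: "x 0 = x0"
    and c: "c < ereal (\<Sum>t<j. stage (x t) (law_input \<mu> x t))
      + V (Suc k) (x j) (data_mat x (law_input \<mu> x) j)"
    by auto
  define u where "u = law_input \<mu> x"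
  define S where "S = (\<Sum>t<j. stage (x t) (u t))"
  define Y where "Y = data_mat x u j"
  have "V (Suc k) (x j) Y \<le> bellman_u Q R (u j) (V k) (x j) Y"
    unfolding value_iter.simps bellman_def by (rule INF_lower) simp
  then have "c < ereal S + bellman_u Q R (u j) (V k) (x j) Y"
    using c unfolding S_def[symmetric] Y_def[symmetric] u_def[symmetric]
    by (meson add_left_mono order_less_le_trans)
  also have "\<dots> = (SUP v. ereal S + (ereal (stage (x j) (u j)) + V k v (Y + outer (block_col (- v) (x j) (u j)))))"
    unfolding bellman_u_def by (subst SUP_ereal_add_right) auto
  finally obtain v where v: "c < ereal S + (ereal (stage (x j) (u j))
      + V k v (Y + outer (block_col (- v) (x j) (u j))))"
    by (auto simp: less_SUP_iff)
  \<comment> \<open>By causality, redirecting the next state to \<open>v\<close> changes neither the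
    inputs up to time \<open>j\<close> nor the data collected before.\<close>
  define y where "y = x(Suc j := v)"
  have y: "y t = x t" if "t \<le> j" for t
    using that by (simp add: y_def)
  then have uy: "law_input \<mu> y t = u t" if "t \<le> j" for t
    unfolding u_def using that by (intro law_input_cong) auto
  have "(\<Sum>t<j. stage (y t) (law_input \<mu> y t)) = S"
    unfolding S_def by (intro sum.cong) (auto simp: y uy)
  moreover have "data_mat y (law_input \<mu> y) j = Y"
    unfolding Y_def data_mat_def by (intro sum.cong) (auto simp: y uy)
  moreover have "y (Suc j) = v"
    by (simp add: y_def)
  ultimately have "c < ereal (\<Sum>t<Suc j. stage (y t) (law_input \<mu> y t))
      + V k (y (Suc j)) (data_mat y (law_input \<mu> y) (Suc j))"
    using v by (simp add: data_mat_def y uy add.assoc[symmetric])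
  moreover have "y 0 = x0"
    using x y by simp
  ultimately show ?case by blast
qed

text \<open>The adversary fixes the states first and picks a nearly best-fitting model afterwards;
  the law cannot react to the model, as it sees only states and inputs.\<close>

lemma V_le_J_cost: "V k x0 0 \<le> J_cost Q R \<gamma> M \<mu> x0"
proof -
  \<comment> \<open>Horizon \<open>k\<close> in \<open>J_cost\<close> has \<open>k + 1\<close>
    stages, hence is compared with \<open>V (Suc k)\<close>.\<close>
  have "V (Suc k) x0 0 \<le> J_cost Q R \<gamma> M \<mu> x0"
  proof (rule dense_le)
    fix c assume "c < V (Suc k) x0 0"
    then obtain x where x: "x 0 = x0"
      and c: "c < ereal (\<Sum>t<Suc k. stage (x t) (law_input \<mu> x t))
        + V 0 (x (Suc k)) (data_mat x (law_input \<mu> x) (Suc k))"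
      using adversary[of c "Suc k" 0] by auto
    define u where "u = law_input \<mu> x"
    have "c < (SUP (A, B)\<in>M. ereal (\<Sum>t<Suc k. stage (x t) (u t))
        + ereal (- \<gamma>\<^sup>2 * misfit A B (data_mat x u (Suc k))))"
      using c unfolding V_0_eq u_def[symmetric] case_prod_beta
      by (subst SUP_ereal_add_right) (auto simp: M_nonempty)
    then obtain A B where AB: "(A, B) \<in> M"
      and c: "c < ereal ((\<Sum>t<Suc k. stage (x t) (u t)) - \<gamma>\<^sup>2 * misfit A B (data_mat x u (Suc k)))"
      by (auto simp: less_SUP_iff)
    \<comment> \<open>The residuals of the chosen model make the prescribed states a trajectory of
      it.\<close>
    define w where "w t = x (Suc t) - A *v x t - B *v u t" for t
    have "trajectory A B \<mu> x0 w x u"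
      unfolding trajectory_def u_def input_history_eq[symmetric] w_def
      by (simp add: x law_input_def)
    then have "ereal (\<Sum>t=0..k. stage (x t) (u t) - \<gamma>\<^sup>2 * (norm (w t))\<^sup>2) \<le> J_cost Q R \<gamma> M \<mu> x0"
      unfolding J_cost_def using AB
      by (intro Sup_upper CollectI exI[of _ w] exI[of _ A] exI[of _ B] exI[of _ k] exI[of _ x]
          exI[of _ u] conjI refl)
    moreover have "(\<Sum>t=0..k. stage (x t) (u t) - \<gamma>\<^sup>2 * (norm (w t))\<^sup>2)
        = (\<Sum>t<Suc k. stage (x t) (u t)) - \<gamma>\<^sup>2 * misfit A B (data_mat x u (Suc k))"
      by (simp add: misfit_data_mat w_def sum_subtractf sum_distrib_left atLeast0AtMost
          lessThan_Suc_atMost del: sum.lessThan_Suc)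
    ultimately show "c \<le> J_cost Q R \<gamma> M \<mu> x0"
      using c by simp
  qed
  with V_le_Suc show ?thesis
    by (rule order_trans)
qed

section \<open>Equality of the optimal values\<close>

lemma V_sup_le_J_opt: "V_sup x0 0 \<le> J_opt Q R \<gamma> M x0"
  unfolding V_sup_def J_opt_def by (intro SUP_least INF_greatest V_le_J_cost)

lemma J_opt_le_G_opt: "J_opt Q R \<gamma> M x0 \<le> G_opt Q R \<gamma> M x0"
  unfolding G_opt_def J_opt_def
proof (rule INF_greatest)
  fix \<eta> :: "('n, 'm) feedback"
  show "(INF \<mu>. J_cost Q R \<gamma> M \<mu> x0) \<le> G_cost Q R \<gamma> M \<eta> x0"
    by (rule INF_lower2[of "induced_law \<eta>"]) (simp_all add: J_cost_induced_le)
qed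

lemma G_cost_minimizer_le:
  assumes "is_minimizer Q R V_sup \<eta>"
  shows "G_cost Q R \<gamma> M \<eta> x0 \<le> V_sup x0 0"
proof (rule verification)
  fix x and Z :: "('n, 'm) blockmat" assume "Z \<in> sym_psd"
  then have "bellman_u Q R (\<eta> x Z) V_sup x Z = V_sup x Z"
    using assms bellman_V_sup unfolding is_minimizer_def by metis
  then show "V 0 x Z \<le> V_sup x Z \<and> bellman_u Q R (\<eta> x Z) V_sup x Z \<le> V_sup x Z"
    using V_le_V_sup[of 0 x Z] by simp
qed

lemma minimizer_exists: "\<exists>\<eta>. is_minimizer Q R V_sup \<eta>"
proof -
  have "\<forall>x Z. \<exists>u. bellman_u Q R u V_sup x Z = bellman Q R V_sup x Z"
    using V_sup_minimizer bellman_V_sup by simp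
  then show ?thesis
    unfolding is_minimizer_def by metis
qed

text \<open>A minimizing feedback closes the chain from \<open>V_sup x0 0\<close> through
  \<open>J_opt\<close> and \<open>G_opt\<close> back to \<open>V_sup x0 0\<close>, also where the
  value is infinite.\<close>

lemma opt_eq:
  shows J_opt_eq: "J_opt Q R \<gamma> M x0 = V_sup x0 0"
    and G_opt_eq: "G_opt Q R \<gamma> M x0 = V_sup x0 0"
proof -
  obtain \<eta> where "is_minimizer Q R V_sup \<eta>"
    using minimizer_exists by blast
  then have "G_opt Q R \<gamma> M x0 \<le> V_sup x0 0"
    unfolding G_opt_def by (intro INF_lower2[OF UNIV_I] G_cost_minimizer_le)
  with V_sup_le_J_opt[of x0] J_opt_le_G_opt[of x0]
  show "J_opt Q R \<gamma> M x0 = V_sup x0 0" "G_opt Q R \<gamma> M x0 = V_sup x0 0"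
    by auto
qed

lemma minimizer_optimal:
  assumes "is_minimizer Q R V_sup \<eta>"
  shows "G_cost Q R \<gamma> M \<eta> x0 = V_sup x0 0" "J_cost Q R \<gamma> M (induced_law \<eta>) x0 = V_sup x0 0"
proof -
  have "V_sup x0 0 \<le> J_cost Q R \<gamma> M (induced_law \<eta>) x0"
    unfolding V_sup_def by (intro SUP_least V_le_J_cost)
  with J_cost_induced_le[of \<eta> x0] G_cost_minimizer_le[OF assms, of x0]
  show "G_cost Q R \<gamma> M \<eta> x0 = V_sup x0 0" "J_cost Q R \<gamma> M (induced_law \<eta>) x0 = V_sup x0 0"
    by auto
qed

section \<open>Finiteness and convergence of the iterates\<close>

lemma V_sup_finite_iff: "\<bar>V_sup x Z\<bar> \<noteq> \<infinity> \<longleftrightarrow> upper_bounded (\<lambda>k. V k x Z)"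
proof
  assume "\<bar>V_sup x Z\<bar> \<noteq> \<infinity>"
  then obtain c where "V_sup x Z = ereal c"
    by auto
  then have "V k x Z \<le> ereal c" for k
    using V_le_V_sup[of k x Z] by simp
  then show "upper_bounded (\<lambda>k. V k x Z)"
    unfolding upper_bounded_def by blast
next
  assume "upper_bounded (\<lambda>k. V k x Z)"
  then obtain c where "V k x Z \<le> ereal c" for k
    unfolding upper_bounded_def by blast
  then have "V_sup x Z \<le> ereal c"
    unfolding V_sup_def by (rule SUP_least)
  then show "\<bar>V_sup x Z\<bar> \<noteq> \<infinity>"
    using V_sup_lower[of x Z] by (cases "V_sup x Z") auto
qed

lemma upper_bounded_psd:
  assumes "upper_bounded (\<lambda>k. V k x 0)" "Z \<in> sym_psd"
  shows "upper_bounded (\<lambda>k. V k x Z)"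
proof -
  obtain c where c: "V k x 0 \<le> ereal c" for k
    using assms(1) unfolding upper_bounded_def by blast
  have "V k x Z \<le> ereal c" for k
    using order_trans[OF V_antimono[OF assms(2), of k x 0] c] by (simp only: add_0)
  then show ?thesis
    unfolding upper_bounded_def by blast
qed

lemma V_tendsto_V_sup: "(\<lambda>k. V k x Z) \<longlonglongrightarrow> V_sup x Z"
  unfolding V_sup_def by (rule LIMSEQ_SUP[OF incseq_V])

end

theorem theorem1:
  fixes Q :: "real^'n^'n" and R :: "real^'m^'m" and \<gamma> :: real
    and M :: "((real^'n^'n) \<times> (real^'m^'n)) set"
  assumes "sym_pos_def Q" and "sym_pos_def R"
    and "M \<noteq> {}" and "compact M"
    and "\<gamma> > 0"
  shows
    "(\<forall>x0. J_opt Q R \<gamma> M x0 = G_opt Q R \<gamma> M x0 \<and>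
        (\<bar>J_opt Q R \<gamma> M x0\<bar> \<noteq> \<infinity> \<longleftrightarrow> upper_bounded (\<lambda>k. value_iter Q R \<gamma> M k x0 0)))
     \<and>
     ((\<forall>x. upper_bounded (\<lambda>k. value_iter Q R \<gamma> M k x 0)) \<longrightarrow>
        (\<forall>x. \<forall>Z\<in>sym_psd.
            (\<lambda>k. value_iter Q R \<gamma> M k x Z) \<longlonglongrightarrow> value_lim Q R \<gamma> M x Z \<and>
            \<bar>value_lim Q R \<gamma> M x Z\<bar> \<noteq> \<infinity>) \<and>
        (\<forall>x0. J_opt Q R \<gamma> M x0 = value_lim Q R \<gamma> M x0 0) \<and>
        (\<exists>\<eta>. is_minimizer Q R (value_lim Q R \<gamma> M) \<eta>) \<and>
        (\<forall>\<eta>. is_minimizer Q R (value_lim Q R \<gamma> M) \<eta> \<longrightarrow>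
            (\<forall>x0. G_cost Q R \<gamma> M \<eta> x0 = G_opt Q R \<gamma> M x0 \<and>
                  J_cost Q R \<gamma> M (induced_law \<eta>) x0 = J_opt Q R \<gamma> M x0)))
     \<and>
     (\<forall>Vb \<eta>b.
        (\<forall>x. \<forall>Z\<in>sym_psd. value_iter Q R \<gamma> M 0 x Z \<le> Vb x Z \<and>
            bellman_u Q R (\<eta>b x Z) Vb x Z \<le> Vb x Z) \<longrightarrow>
        (\<forall>x0. J_cost Q R \<gamma> M (induced_law \<eta>b) x0 \<le> Vb x0 0))"
proof -
  interpret minimax_problem Q R \<gamma> M
    using assms by unfold_locales
  have finite: "\<bar>V_sup x Z\<bar> \<noteq> \<infinity>" if "\<forall>x. upper_bounded (\<lambda>k. V k x 0)" "Z \<in> sym_psd" for x Z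
    unfolding V_sup_finite_iff by (rule upper_bounded_psd[OF that(1)[rule_format] that(2)])
  have super: "J_cost Q R \<gamma> M (induced_law \<eta>b) x0 \<le> Vb x0 0"
    if "\<forall>x. \<forall>Z\<in>sym_psd. V 0 x Z \<le> Vb x Z \<and> bellman_u Q R (\<eta>b x Z) Vb x Z \<le> Vb x Z"
    for Vb \<eta>b x0
    by (rule order_trans[OF J_cost_induced_le verification[where W = Vb]]) (rule that[rule_format])
  \<comment> \<open>Once the limit and both optimal values are rewritten to \<open>V_sup\<close>,
    the claimed equalities are reflexive.\<close>
  show ?thesis
    unfolding value_lim_eq J_opt_eq G_opt_eq
  proof (intro conjI)
    show "\<forall>x0. V_sup x0 0 = V_sup x0 0 \<and>
        (\<bar>V_sup x0 0\<bar> \<noteq> \<infinity> \<longleftrightarrow> upper_bounded (\<lambda>k. V k x0 0))"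
      by (intro allI conjI refl V_sup_finite_iff)
  next
    show "\<forall>Vb \<eta>b. (\<forall>x. \<forall>Z\<in>sym_psd. V 0 x Z \<le> Vb x Z \<and> bellman_u Q R (\<eta>b x Z) Vb x Z \<le> Vb x Z) \<longrightarrow>
        (\<forall>x0. J_cost Q R \<gamma> M (induced_law \<eta>b) x0 \<le> Vb x0 0)"
      by (intro allI impI) (rule super)
  next
    show "(\<forall>x. upper_bounded (\<lambda>k. V k x 0)) \<longrightarrow>
        (\<forall>x. \<forall>Z\<in>sym_psd. (\<lambda>k. V k x Z) \<longlonglongrightarrow> V_sup x Z \<and> \<bar>V_sup x Z\<bar> \<noteq> \<infinity>) \<and>
        (\<forall>x0. V_sup x0 0 = V_sup x0 0) \<and>
        (\<exists>\<eta>. is_minimizer Q R V_sup \<eta>) \<and>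
        (\<forall>\<eta>. is_minimizer Q R V_sup \<eta> \<longrightarrow>
            (\<forall>x0. G_cost Q R \<gamma> M \<eta> x0 = V_sup x0 0 \<and>
                  J_cost Q R \<gamma> M (induced_law \<eta>) x0 = V_sup x0 0))"
    proof (intro impI)
      assume bounded: "\<forall>x. upper_bounded (\<lambda>k. V k x 0)"
      show "(\<forall>x. \<forall>Z\<in>sym_psd. (\<lambda>k. V k x Z) \<longlonglongrightarrow> V_sup x Z \<and> \<bar>V_sup x Z\<bar> \<noteq> \<infinity>) \<and>
        (\<forall>x0. V_sup x0 0 = V_sup x0 0) \<and>
        (\<exists>\<eta>. is_minimizer Q R V_sup \<eta>) \<and>
        (\<forall>\<eta>. is_minimizer Q R V_sup \<eta> \<longrightarrow>
            (\<forall>x0. G_cost Q R \<gamma> M \<eta> x0 = V_sup x0 0 \<and>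
                  J_cost Q R \<gamma> M (induced_law \<eta>) x0 = V_sup x0 0))"
        by (intro conjI allI impI ballI refl V_tendsto_V_sup finite[OF bounded] minimizer_exists
            minimizer_optimal)
    qed
  qed
qed

end
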